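(* The map $\mathrm{Prune}:\mathcal{T}\to\mathrm{PT}$, sending a binary tree $T$ to the unique pruned binary tree $T_p$ with $[T_p]=[T]$, is computable (as a map between $\mathbb{T}^\omega$-represented spaces), and its multivalued inverse $\mathrm{PT}\rightrightarrows\mathcal{T}$, $P\mapsto\{T\in\mathcal{T}\mid\mathrm{Prune}(T)=P\}$, is computable.
   Context: A binary tree is a set $T\subseteq\{0,1\}^*$ closed under prefixes $\sqsubseteq$; $[T]$ is the set of $p\in\{0,1\}^\omega$ with all finite prefixes in $T$. $T$ is pruned if every $w\in T$ has a proper extension in $T$. Fix a standard computable bijection $\nu:\mathbb{N}\to\{0,1\}^*$. The represented space $\mathcal{T}$ of binary trees represents $T$ by its characteristic sequence $n\mapsto\chi_T(\nu(n))\in\{0,1\}^\omega$. Plotkin's $\mathbb{T}=\{0,1,\bot\}$ is represented by $\delta_\mathbb{T}(0^\omega)=\bot$, $\delta_\mathbb{T}(p)=0$ if $\min\{n\mid p(n)=1\}$ is even and $1$ if odd; $\mathbb{T}^\omega$ carries the induced product representation $\delta_{\mathbb{T}^\omega}$. A $\mathbb{T}^\omega$-represented space is a set $Y$ with a partial surjection $\psi_Y:\subseteq\mathbb{T}^\omega\to Y$; ordinary represented spaces are special cases since $\{0,1\}^\omega\subseteq\mathbb{T}^\omega$. A multivalued $F:\subseteq\mathbb{T}^\omega\rightrightarrows\mathbb{T}^\omega$ is computable if some computable $G:\subseteq\{0,1\}^\omega\to\{0,1\}^\omega$ satisfies $\delta_{\mathbb{T}^\omega}(G(r))\in F(\delta_{\mathbb{T}^\omega}(r))$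 whenever $\delta_{\mathbb{T}^\omega}(r)\in\operatorname{dom}(F)$. $F$ is a $\mathbb{T}^\omega$-realizer of $f:\subseteq Y\rightrightarrows Z$ if $\emptyset\neq\psi_Z(F(p))\subseteq f(\psi_Y(p))$ for all $p\in\operatorname{dom}(f\circ\psi_Y)$; $f$ is computable if it has a computable $\mathbb{T}^\omega$-realizer. $\mathrm{PT}$ is the set of pruned binary trees with the $\mathbb{T}^\omega$-representation $\delta_{\mathrm{PT}}:\mathbb{T}^\omega\to\mathrm{PT}$: $\delta_{\mathrm{PT}}(p)=\emptyset$ if $p(0)\neq\bot$; if $p(0)=\bot$, then $\delta_{\mathrm{PT}}(p)$ is the tree $T$ with $\varepsilon\in T$ and such that for every $w\in T$ with $n=\nu^{-1}(w)$: $w0\in T$ iff $p(n+1)\neq1$, and $w1\in T$ iff $p(n+1)\neq0$. *)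

theory Defs
  imports "HOL-Library.Sublist" "HOL-Library.Nat_Bijection"
begin

section \<open>Computable partial functions on Cantor space\<close>

text \<open>
  Partial recursive functions relative to an oracle \<open>p\<close> in Cantor space. Evaluation is partial
  (\<open>None\<close> means undefined), and an ill-formed argument list also yields \<open>None\<close>.
  In \<open>Mu f\<close> all values of \<open>f\<close> below the least zero have to be defined.
\<close>

datatype prog =
    Zero
  | Succ
  | Proj nat
  | Query
  | Comp prog "prog list"
  | PrimRec prog prog
  | Mu prog

primrec eval :: "prog \<Rightarrow> (nat \<Rightarrow> bool) \<Rightarrow> nat list \<Rightarrow> nat option" where
  "eval Zero p xs = Some 0"
| "eval Succ p xs = (case xs of [x] \<Rightarrow> Some (Suc x) | _ \<Rightarrow> None)"
| "eval (Proj i) p xs = (if i < length xs then Some (xs ! i) else None)"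
| "eval Query p xs = (case xs of [x] \<Rightarrow> Some (of_bool (p x)) | _ \<Rightarrow> None)"
| "eval (Comp f gs) p xs =
     (let vs = map (\<lambda>e. e p xs) (map eval gs)
      in if None \<in> set vs then None else eval f p (map the vs))"
| "eval (PrimRec f g) p xs =
     (case xs of
        [] \<Rightarrow> None
      | y # ys \<Rightarrow>
          rec_nat (eval f p ys) (\<lambda>n a. Option.bind a (\<lambda>v. eval g p (n # v # ys))) y)"
| "eval (Mu f) p xs =
     (if \<exists>n. eval f p (n # xs) = Some 0 \<and> (\<forall>m<n. eval f p (m # xs) \<noteq> None)
      then Some (LEAST n. eval f p (n # xs) = Some 0) else None)"

text \<open>
  \<open>G\<close> is computable if a single oracle program, run with oracle \<open>p\<close>, computes the sequence
  \<open>G p\<close> for every \<open>p\<close> in the domain of \<open>G\<close>; nothing is required outside the domain.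
\<close>

definition cantor_computable :: "((nat \<Rightarrow> bool) \<rightharpoonup> (nat \<Rightarrow> bool)) \<Rightarrow> bool" where
  "cantor_computable G \<longleftrightarrow>
     (\<exists>c. \<forall>p q. G p = Some q \<longrightarrow> (\<forall>n. eval c p [n] = Some (of_bool (q n))))"


section \<open>Plotkin's T and represented spaces over its sequences\<close>

text \<open>\<open>None\<close> is bottom, \<open>Some False\<close> is 0 and \<open>Some True\<close> is 1.\<close>

type_synonym plotkin = "bool option"

definition delta_T :: "(nat \<Rightarrow> bool) \<Rightarrow> plotkin" where
  "delta_T p = (if \<exists>n. p n then Some (odd (LEAST n. p n)) else None)"

text \<open>The product representation, with the \<open>n\<close>-th component of \<open>p\<close> read off by Cantor pairing.\<close>

definition delta_Tw :: "(nat \<Rightarrow> bool) \<Rightarrow> (nat \<Rightarrow> plotkin)" where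
  "delta_Tw p = (\<lambda>n. delta_T (\<lambda>k. p (prod_encode (n, k))))"

text \<open>
  A partial multivalued function is a set-valued function whose domain consists of the
  points with nonempty value.
\<close>

definition mdom :: "('a \<Rightarrow> 'b set) \<Rightarrow> 'a set" where
  "mdom f = {x. f x \<noteq> {}}"

definition Tw_computable :: "((nat \<Rightarrow> plotkin) \<Rightarrow> (nat \<Rightarrow> plotkin) set) \<Rightarrow> bool" where
  "Tw_computable F \<longleftrightarrow>
     (\<exists>G. cantor_computable G \<and>
        (\<forall>r. delta_Tw r \<in> mdom F \<longrightarrow>
           (\<exists>s. G r = Some s \<and> delta_Tw s \<in> F (delta_Tw r))))"

definition Tw_representation :: "'y set \<Rightarrow> ((nat \<Rightarrow> plotkin) \<rightharpoonup> 'y) \<Rightarrow> bool" where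
  "Tw_representation Y \<psi> \<longleftrightarrow> ran \<psi> = Y"

text \<open>An ordinary representation as a representation defined on the bottom-free sequences only.\<close>

definition Tw_of_cantor :: "((nat \<Rightarrow> bool) \<rightharpoonup> 'y) \<Rightarrow> ((nat \<Rightarrow> plotkin) \<rightharpoonup> 'y)" where
  "Tw_of_cantor \<delta> p = (if None \<in> range p then None else \<delta> (\<lambda>n. the (p n)))"

text \<open>
  As usual for the composition of a partial function with a multivalued one, for \<open>\<psi>Z (F p)\<close>
  to be defined every element of \<open>F p\<close> has to lie in the domain of \<open>\<psi>Z\<close>.
\<close>

definition Tw_realizer ::
  "((nat \<Rightarrow> plotkin) \<rightharpoonup> 'y) \<Rightarrow> ((nat \<Rightarrow> plotkin) \<rightharpoonup> 'z) \<Rightarrow>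
   ((nat \<Rightarrow> plotkin) \<Rightarrow> (nat \<Rightarrow> plotkin) set) \<Rightarrow> ('y \<Rightarrow> 'z set) \<Rightarrow> bool" where
  "Tw_realizer \<psi>Y \<psi>Z F f \<longleftrightarrow>
     (\<forall>p y. \<psi>Y p = Some y \<and> y \<in> mdom f \<longrightarrow>
        F p \<noteq> {} \<and> F p \<subseteq> dom \<psi>Z \<and> (\<lambda>q. the (\<psi>Z q)) ` F p \<subseteq> f y)"

definition Tw_map_computable ::
  "((nat \<Rightarrow> plotkin) \<rightharpoonup> 'y) \<Rightarrow> ((nat \<Rightarrow> plotkin) \<rightharpoonup> 'z) \<Rightarrow> ('y \<Rightarrow> 'z set) \<Rightarrow> bool" where
  "Tw_map_computable \<psi>Y \<psi>Z f \<longleftrightarrow> (\<exists>F. Tw_computable F \<and> Tw_realizer \<psi>Y \<psi>Z F f)"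


section \<open>Binary trees\<close>

definition binary_trees :: "bool list set set" where
  "binary_trees = {T. \<forall>w\<in>T. \<forall>v. prefix v w \<longrightarrow> v \<in> T}"

definition paths :: "bool list set \<Rightarrow> (nat \<Rightarrow> bool) set" where
  "paths T = {p. \<forall>n. map p [0..<n] \<in> T}"

definition pruned_trees :: "bool list set set" where
  "pruned_trees = {T \<in> binary_trees. \<forall>w\<in>T. \<exists>v\<in>T. strict_prefix w v}"

definition Prune :: "bool list set \<Rightarrow> bool list set" where
  "Prune T = (THE P. P \<in> pruned_trees \<and> paths P = paths T)"

text \<open>
  The length-lexicographic enumeration of binary words: \<open>nu n\<close> is the binary expansion of
  \<open>n + 1\<close> without its leading 1.
\<close>

fun nu :: "nat \<Rightarrow> bool list" where
  "nu 0 = []"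
| "nu (Suc n) = nu (n div 2) @ [odd n]"

definition delta_tree :: "(nat \<Rightarrow> bool) \<rightharpoonup> bool list set" where
  "delta_tree q = (let T = {nu n | n. q n} in if T \<in> binary_trees then Some T else None)"

inductive_set PT_tree :: "(nat \<Rightarrow> plotkin) \<Rightarrow> bool list set" for p :: "nat \<Rightarrow> plotkin" where
  root: "p 0 = None \<Longrightarrow> [] \<in> PT_tree p"
| left: "w \<in> PT_tree p \<Longrightarrow> p (inv nu w + 1) \<noteq> Some True \<Longrightarrow> w @ [False] \<in> PT_tree p"
| right: "w \<in> PT_tree p \<Longrightarrow> p (inv nu w + 1) \<noteq> Some False \<Longrightarrow> w @ [True] \<in> PT_tree p"

definition delta_PT :: "(nat \<Rightarrow> plotkin) \<rightharpoonup> bool list set" where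
  "delta_PT p = Some (PT_tree p)"

subsection \<open>The definitions are well posed\<close>

lemma bij_nu: "bij nu"
proof (rule bijI)
  show "inj nu"
  proof (rule injI)
    fix m n show "nu m = nu n \<Longrightarrow> m = n"
    proof (induction m arbitrary: n rule: nu.induct)
      case 1
      then show ?case by (cases n) auto
    next
      case (2 m)
      then obtain k where k: "n = Suc k" by (cases n) auto
      with 2 have "m div 2 = k div 2" "odd m = odd k" by auto
      then have "m = k" by presburger
      with k show ?case by simp
    qed
  qed
  show "surj nu"
  proof (rule surjI[where f = "\<lambda>w. SOME n. nu n = w"])
    fix w
    have "\<exists>n. nu n = w"
    proof (induction w rule: rev_induct)
      case Nil
      show ?case by (rule exI[of _ 0]) simp
    next
      case (snoc b w)
      then obtain n where "nu n = w" by blast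
      then have "nu (Suc (2 * n + of_bool b)) = w @ [b]" by simp
      then show ?case by blast
    qed
    then show "nu (SOME n. nu n = w) = w" by (rule someI_ex)
  qed
qed

lemma delta_tree_eq_Some_iff:
  "delta_tree q = Some T \<longleftrightarrow> T \<in> binary_trees \<and> q = (\<lambda>n. nu n \<in> T)"
proof
  assume "delta_tree q = Some T"
  then have T: "T \<in> binary_trees" "T = {nu n | n. q n}"
    unfolding delta_tree_def Let_def by (simp_all split: if_split_asm)
  have "q n \<longleftrightarrow> nu n \<in> T" for n
    unfolding T(2) using bij_is_inj[OF bij_nu] by (blast dest: injD)
  with T(1) show "T \<in> binary_trees \<and> q = (\<lambda>n. nu n \<in> T)" by blast
next
  assume q: "T \<in> binary_trees \<and> q = (\<lambda>n. nu n \<in> T)"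
  have "w \<in> {nu n | n. nu n \<in> T} \<longleftrightarrow> w \<in> T" for w
    using surjD[OF bij_is_surj[OF bij_nu], of w] by blast
  then have "{nu n | n. nu n \<in> T} = T" by blast
  with q show "delta_tree q = Some T" by (simp add: delta_tree_def)
qed

lemma Tw_representation_tree: "Tw_representation binary_trees (Tw_of_cantor delta_tree)"
  unfolding Tw_representation_def
proof (intro equalityI subsetI)
  fix T assume "T \<in> ran (Tw_of_cantor delta_tree)"
  then show "T \<in> binary_trees"
    by (auto simp: ran_def Tw_of_cantor_def delta_tree_eq_Some_iff split: if_splits)
next
  fix T assume "T \<in> binary_trees"
  then have "Tw_of_cantor delta_tree (\<lambda>n. Some (nu n \<in> T)) = Some T"
    by (auto simp: Tw_of_cantor_def delta_tree_eq_Some_iff)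
  then show "T \<in> ran (Tw_of_cantor delta_tree)" by (auto simp: ran_def)
qed

lemma PT_tree_Nil_iff: "[] \<in> PT_tree p \<longleftrightarrow> p 0 = None"
  by (auto elim: PT_tree.cases intro: PT_tree.root)

lemma PT_tree_snoc_iff:
  "w @ [b] \<in> PT_tree p \<longleftrightarrow> w \<in> PT_tree p \<and> p (inv nu w + 1) \<noteq> Some (\<not> b)"
proof
  assume "w @ [b] \<in> PT_tree p"
  then show "w \<in> PT_tree p \<and> p (inv nu w + 1) \<noteq> Some (\<not> b)"
    by cases auto
next
  assume "w \<in> PT_tree p \<and> p (inv nu w + 1) \<noteq> Some (\<not> b)"
  then show "w @ [b] \<in> PT_tree p"
    by (cases b) (auto intro: PT_tree.left PT_tree.right)
qed

lemma binary_trees_iff_snoc: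
  "T \<in> binary_trees \<longleftrightarrow> (\<forall>w b. w @ [b] \<in> T \<longrightarrow> w \<in> T)"
proof
  assume *: "\<forall>w b. w @ [b] \<in> T \<longrightarrow> w \<in> T"
  have "v @ u \<in> T \<longrightarrow> v \<in> T" for v u
  proof (induction u rule: rev_induct)
    case (snoc b u)
    then show ?case using *[rule_format, of "v @ u" b] by auto
  qed simp
  then show "T \<in> binary_trees" by (auto simp: binary_trees_def prefix_def)
qed (auto simp: binary_trees_def prefix_def)

lemma pruned_trees_iff_snoc:
  "T \<in> pruned_trees \<longleftrightarrow> T \<in> binary_trees \<and> (\<forall>w\<in>T. \<exists>b. w @ [b] \<in> T)"
proof
  assume T: "T \<in> pruned_trees"
  have "\<exists>b. w @ [b] \<in> T" if "w \<in> T" for w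
  proof -
    have "\<forall>w\<in>T. \<exists>v\<in>T. strict_prefix w v" using T by (simp add: pruned_trees_def)
    from bspec[OF this that] obtain v where v: "v \<in> T" "strict_prefix w v" ..
    then obtain b u where "v = w @ b # u" by (blast elim: strict_prefixE')
    then have "prefix (w @ [b]) v" by simp
    moreover have "T \<in> binary_trees" using T by (simp add: pruned_trees_def)
    ultimately have "w @ [b] \<in> T" using v(1) by (auto simp: binary_trees_def)
    then show ?thesis ..
  qed
  with T show "T \<in> binary_trees \<and> (\<forall>w\<in>T. \<exists>b. w @ [b] \<in> T)"
    by (simp add: pruned_trees_def)
next
  assume *: "T \<in> binary_trees \<and> (\<forall>w\<in>T. \<exists>b. w @ [b] \<in> T)"
  have "strict_prefix w (w @ [b])" for w and b :: bool by (simp add: strict_prefix_def)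
  with * show "T \<in> pruned_trees"
    unfolding pruned_trees_def by blast
qed

lemma Tw_representation_PT: "Tw_representation pruned_trees delta_PT"
  unfolding Tw_representation_def
proof (intro equalityI subsetI)
  fix P assume "P \<in> ran delta_PT"
  then obtain p where P: "P = PT_tree p" by (auto simp: ran_def delta_PT_def)
  have "\<exists>b. p (inv nu w + 1) \<noteq> Some (\<not> b)" for w
    by (cases "p (inv nu w + 1)") auto
  then show "P \<in> pruned_trees"
    unfolding P pruned_trees_iff_snoc binary_trees_iff_snoc PT_tree_snoc_iff by blast
next
  fix P assume P: "P \<in> pruned_trees"
  define p :: "nat \<Rightarrow> plotkin" where "p = (\<lambda>n. case n of
      0 \<Rightarrow> if [] \<in> P then None else Some True
    | Suc m \<Rightarrow> if nu m @ [False] \<in> P \<and> nu m @ [True] \<in> P then None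
               else Some (nu m @ [True] \<in> P))"
  have nu: "nu (inv nu w) = w" for w
    using bij_nu by (simp add: bij_def surj_f_inv_f)
  have "w \<in> PT_tree p \<longleftrightarrow> w \<in> P" for w
  proof (induction w rule: rev_induct)
    case Nil
    show ?case by (simp add: PT_tree_Nil_iff p_def)
  next
    case (snoc b w)
    have "w \<in> P" if "w @ [b] \<in> P"
      using P that unfolding pruned_trees_iff_snoc binary_trees_iff_snoc by blast
    moreover have "w @ [False] \<in> P \<or> w @ [True] \<in> P" if "w \<in> P"
      using P that unfolding pruned_trees_iff_snoc by (metis (full_types))
    ultimately show ?case
      using snoc by (cases b) (auto simp: PT_tree_snoc_iff p_def nu)
  qed
  then have "delta_PT p = Some P" by (auto simp: delta_PT_def)
  then show "P \<in> ran delta_PT" by (auto simp: ran_def)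
qed

lemma pruned_tree_word_on_path:
  assumes P: "P \<in> pruned_trees" and w: "w \<in> P"
  shows "\<exists>p\<in>paths P. map p [0..<length w] = w"
proof -
  define c where "c v = (SOME b. v @ [b] \<in> P)" for v
  define s where "s n = ((\<lambda>v. v @ [c v]) ^^ n) w" for n
  have c: "v @ [c v] \<in> P" if "v \<in> P" for v
    unfolding c_def by (rule someI_ex) (use P that in \<open>unfold pruned_trees_iff_snoc, blast\<close>)
  have s_in: "s n \<in> P" for n
    by (induction n) (auto simp: s_def w intro: c)
  have s_len: "length (s n) = length w + n" for n
    by (induction n) (auto simp: s_def)
  have s_mono: "prefix (s m) (s (m + k))" for m k
  proof (induction k)
    case (Suc k)
    have "prefix (s (m + k)) (s (m + Suc k))" by (simp add: s_def)
    with Suc show ?case by (rule prefix_order.trans)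
  qed simp
  define p where "p i = s (Suc i) ! i" for i
  have p: "p i = s n ! i" if "i < length (s n)" for i n
  proof (cases "n \<le> Suc i")
    case True
    then obtain k where "Suc i = n + k" using le_Suc_ex by blast
    then show ?thesis using s_mono[of n k] that by (auto simp: p_def prefix_def nth_append)
  next
    case False
    then obtain k where "n = Suc i + k" by (metis le_Suc_ex nat_le_linear)
    then show ?thesis using s_mono[of "Suc i" k] s_len[of "Suc i"]
      by (auto simp: p_def prefix_def nth_append)
  qed
  have take_s: "map p [0..<m] = take m (s n)" if "m \<le> length (s n)" for m n
    by (rule nth_equalityI) (use that in \<open>auto simp: p\<close>)
  have "map p [0..<n] \<in> P" for n
  proof -
    have "map p [0..<n] = take n (s n)" by (rule take_s) (simp add: s_len)
    then show ?thesis using s_in[of n] P take_is_prefix[of n "s n"]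
      unfolding pruned_trees_def binary_trees_def by auto
  qed
  moreover have "map p [0..<length w] = w"
    using take_s[of "length w" 0] by (simp add: s_def)
  ultimately show ?thesis by (auto simp: paths_def)
qed

lemma Prune_unique_exists:
  assumes T: "T \<in> binary_trees"
  shows "\<exists>!P. P \<in> pruned_trees \<and> paths P = paths T"
proof (rule ex1I)
  define P where "P = {map p [0..<n] | p n. p \<in> paths T}"
  have "P \<in> pruned_trees"
    unfolding pruned_trees_iff_snoc binary_trees_iff_snoc
  proof (intro conjI allI impI ballI)
    fix w b assume "w @ [b] \<in> P"
    then obtain p n where p: "w @ [b] = map p [0..<n]" "p \<in> paths T" by (auto simp: P_def)
    then obtain m where "n = Suc m" by (cases n) auto
    with p have "w = map p [0..<m]" by simp
    with p show "w \<in> P" by (auto simp: P_def)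
  next
    fix w assume "w \<in> P"
    then obtain p n where p: "w = map p [0..<n]" "p \<in> paths T" by (auto simp: P_def)
    then have "w @ [p n] = map p [0..<Suc n]" by simp
    with p show "\<exists>b. w @ [b] \<in> P" unfolding P_def by blast
  qed
  moreover have "P \<subseteq> T" by (auto simp: P_def paths_def)
  then have "paths P = paths T"
    by (auto simp: paths_def P_def)
  ultimately show "P \<in> pruned_trees \<and> paths P = paths T" by blast
  fix Q assume Q: "Q \<in> pruned_trees \<and> paths Q = paths T"
  show "Q = P"
  proof (intro equalityI subsetI)
    fix w assume "w \<in> Q"
    then obtain p where "p \<in> paths T" "map p [0..<length w] = w"
      using pruned_tree_word_on_path Q by metis
    then show "w \<in> P" unfolding P_def by (metis (mono_tags, lifting) mem_Collect_eq)
  next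
    fix w assume "w \<in> P"
    then show "w \<in> Q" using Q by (auto simp: P_def paths_def)
  qed
qed

end

theory Submission imports Defs begin

text \<open>
  Call a node of \<open>T\<close> dead at level \<open>k\<close> if it has no extension by \<open>k\<close> letters in \<open>T\<close>. This is
  decidable in \<open>T\<close>, and by Koenig's lemma a word is missing from \<open>Prune T\<close> iff it is dead at some
  level. So, given \<open>w\<close>, one waits for one of the two children of \<open>w\<close> to die and then names the
  other one; if \<open>w\<close> itself lies in \<open>Prune T\<close>, at most one of them ever dies.

  Conversely, given a name of a pruned tree \<open>P\<close>, put the word with index \<open>n\<close> into \<open>T\<close> unless the
  first \<open>n\<close> entries of each component of the name already show that one of its prefixes is not
  in \<open>P\<close>. A word outside \<open>P\<close> can thus only have finitely many extensions in \<open>T\<close>.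
\<close>

section \<open>Total functions computable relative to an oracle\<close>

text \<open>Unbounded search may terminate for some oracles only. Hence totality is demanded on a
  set \<open>D\<close> of oracles, later the names of points of the source space.\<close>

definition computable ::
  "(nat \<Rightarrow> bool) set \<Rightarrow> nat \<Rightarrow> ((nat \<Rightarrow> bool) \<Rightarrow> nat list \<Rightarrow> nat) \<Rightarrow> bool" where
  "computable D a f \<longleftrightarrow>
     (\<exists>c. \<forall>p\<in>D. \<forall>xs. length xs = a \<longrightarrow> eval c p xs = Some (f p xs))"

abbreviation decidable ::
  "(nat \<Rightarrow> bool) set \<Rightarrow> nat \<Rightarrow> ((nat \<Rightarrow> bool) \<Rightarrow> nat list \<Rightarrow> bool) \<Rightarrow> bool" where
  "decidable D a P \<equiv> computable D a (\<lambda>p xs. of_bool (P p xs))"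

lemma computableI:
  assumes "\<And>p xs. p \<in> D \<Longrightarrow> length xs = a \<Longrightarrow> eval c p xs = Some (f p xs)"
  shows "computable D a f"
  using assms unfolding computable_def by blast

lemma computable_cong:
  assumes "computable D a f" and "\<And>p xs. p \<in> D \<Longrightarrow> length xs = a \<Longrightarrow> g p xs = f p xs"
  shows "computable D a g"
  using assms unfolding computable_def by fastforce

lemma computable_nth: "i < a \<Longrightarrow> computable D a (\<lambda>p xs. xs ! i)"
  by (rule computableI[where c = "Proj i"]) simp

lemma computable_Suc:
  assumes "computable D a f"
  shows "computable D a (\<lambda>p xs. Suc (f p xs))"
proof -
  obtain c where "\<And>p xs. p \<in> D \<Longrightarrow> length xs = a \<Longrightarrow> eval c p xs = Some (f p xs)"
    using assms unfolding computable_def by blast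
  then show ?thesis by (intro computableI[where c = "Comp Succ [c]"]) simp
qed

lemma computable_const: "computable D a (\<lambda>p xs. n)"
proof (induction n)
  case 0
  show ?case by (rule computableI[where c = Zero]) simp
qed (rule computable_Suc)

lemma decidable_query:
  assumes "computable D a f"
  shows "decidable D a (\<lambda>p xs. p (f p xs))"
proof -
  obtain c where "\<And>p xs. p \<in> D \<Longrightarrow> length xs = a \<Longrightarrow> eval c p xs = Some (f p xs)"
    using assms unfolding computable_def by blast
  then show ?thesis by (intro computableI[where c = "Comp Query [c]"]) simp
qed

text \<open>Composition has no implicit parameters, so a program passes its arguments on by a list
  of projections. The left side is the form in which evaluation of \<open>Comp\<close> produces
  them.\<close>

lemma map_eval_Proj:
  assumes "length xs = m + n"
  shows "map (\<lambda>e. e p xs) (map eval (map Proj [m..<m + n])) = map Some (drop m xs)"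
  using assms by (intro nth_equalityI) auto

text \<open>Weakening: recursion, bounded quantifiers and search put their own variables in front of
  the parameters, and a function of the parameters alone has to skip these.\<close>

lemma computable_drop:
  assumes "computable D a f"
  shows "computable D (k + a) (\<lambda>p xs. f p (drop k xs))"
proof -
  obtain c where c: "\<And>p xs. p \<in> D \<Longrightarrow> length xs = a \<Longrightarrow> eval c p xs = Some (f p xs)"
    using assms unfolding computable_def by blast
  show ?thesis
  proof (rule computableI[where c = "Comp c (map Proj [k..<k + a])"])
    fix p and xs :: "nat list" assume "p \<in> D" "length xs = k + a"
    then show "eval (Comp c (map Proj [k..<k + a])) p xs = Some (f p (drop k xs))"
      by (simp only: eval.simps map_eval_Proj Let_def) (auto simp: c o_def)
  qed
qed

text \<open>\<open>PrimRec\<close> hands the counter and the previous value to the step as arguments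
  0 and 1, so the parameters are found behind \<open>drop 2\<close>. Composing with \<open>h\<close>
  makes the recursion depth arbitrary.\<close>

lemma computable_rec_nat:
  assumes "computable D a f" "computable D a h"
    and "computable D (Suc (Suc a)) (\<lambda>p ys. g p (ys ! 0) (ys ! 1) (drop 2 ys))"
  shows "computable D a (\<lambda>p xs. rec_nat (f p xs) (\<lambda>n v. g p n v xs) (h p xs))"
proof -
  obtain cf where cf: "\<And>p xs. p \<in> D \<Longrightarrow> length xs = a \<Longrightarrow> eval cf p xs = Some (f p xs)"
    using assms(1) unfolding computable_def by blast
  obtain ch where ch: "\<And>p xs. p \<in> D \<Longrightarrow> length xs = a \<Longrightarrow> eval ch p xs = Some (h p xs)"
    using assms(2) unfolding computable_def by blast
  obtain cg where cg: "\<And>p ys. p \<in> D \<Longrightarrow> length ys = Suc (Suc a) \<Longrightarrow>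
      eval cg p ys = Some (g p (ys ! 0) (ys ! 1) (drop 2 ys))"
    using assms(3) unfolding computable_def by blast
  show ?thesis
  proof (rule computableI[where c = "Comp (PrimRec cf cg) (ch # map Proj [0..<0 + a])"])
    fix p and xs :: "nat list" assume p: "p \<in> D" and xs: "length xs = a"
    have "eval (PrimRec cf cg) p (n # xs) = Some (rec_nat (f p xs) (\<lambda>n v. g p n v xs) n)" for n
      by (induction n) (simp_all add: cf cg p xs)
    moreover have "eval (Comp (PrimRec cf cg) (ch # map Proj [0..<0 + a])) p xs =
        eval (PrimRec cf cg) p (h p xs # xs)"
      by (subst eval.simps(5), subst list.map, subst list.map, subst map_eval_Proj)
        (auto simp: xs ch p o_def Let_def simp del: eval.simps)
    ultimately show "eval (Comp (PrimRec cf cg) (ch # map Proj [0..<0 + a])) p xs =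
        Some (rec_nat (f p xs) (\<lambda>n v. g p n v xs) (h p xs))"
      by simp
  qed
qed

lemma computable_drop2:
  "computable D a f \<Longrightarrow> computable D (Suc (Suc a)) (\<lambda>p xs. f p (drop 2 xs))"
  using computable_drop[of D a f 2] by simp

section \<open>Arithmetic and Boolean operations\<close>

lemma computable_add:
  assumes "computable D a f" "computable D a g"
  shows "computable D a (\<lambda>p xs. f p xs + g p xs)"
proof (rule computable_cong)
  show "computable D a (\<lambda>p xs. rec_nat (f p xs) (\<lambda>n v. Suc v) (g p xs))"
    by (intro computable_rec_nat assms computable_Suc computable_nth) simp
  have "rec_nat x (\<lambda>n v. Suc v) y = x + y" for x y by (induction y) auto
  then show "f p xs + g p xs = rec_nat (f p xs) (\<lambda>n v. Suc v) (g p xs)" for p xs by simp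
qed

lemma computable_mult:
  assumes "computable D a f" "computable D a g"
  shows "computable D a (\<lambda>p xs. f p xs * g p xs)"
proof (rule computable_cong)
  show "computable D a (\<lambda>p xs. rec_nat 0 (\<lambda>n v. f p xs + v) (g p xs))"
    by (intro computable_rec_nat assms computable_add computable_nth computable_const
        computable_drop2) simp
  have "rec_nat 0 (\<lambda>n v. x + v) y = x * y" for x y :: nat by (induction y) auto
  then show "f p xs * g p xs = rec_nat 0 (\<lambda>n v. f p xs + v) (g p xs)" for p xs by simp
qed

lemma computable_diff:
  assumes "computable D a f" "computable D a g"
  shows "computable D a (\<lambda>p xs. f p xs - g p xs)"
proof (rule computable_cong)
  \<comment> \<open>Predecessor: the step returns the counter, whose last value is one below the
    recursion depth.\<close>
  have pred: "computable D b (\<lambda>p xs. h p xs - 1)" if "computable D b h" for b h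
  proof (rule computable_cong)
    show "computable D b (\<lambda>p xs. rec_nat 0 (\<lambda>n v. n) (h p xs))"
      by (intro computable_rec_nat that computable_nth computable_const) simp
    show "h p xs - 1 = rec_nat 0 (\<lambda>n v. n) (h p xs)" for p xs by (cases "h p xs") auto
  qed
  show "computable D a (\<lambda>p xs. rec_nat (f p xs) (\<lambda>n v. v - 1) (g p xs))"
    by (intro computable_rec_nat assms pred computable_nth) simp
  have "rec_nat x (\<lambda>n v. v - 1) y = x - y" for x y :: nat by (induction y) auto
  then show "f p xs - g p xs = rec_nat (f p xs) (\<lambda>n v. v - 1) (g p xs)" for p xs by simp
qed

lemma decidable_not:
  assumes "decidable D a P"
  shows "decidable D a (\<lambda>p xs. \<not> P p xs)"
proof (rule computable_cong)
  show "computable D a (\<lambda>p xs. 1 - of_bool (P p xs))"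
    by (intro computable_diff computable_const assms)
qed simp

lemma decidable_conj:
  assumes "decidable D a P" "decidable D a Q"
  shows "decidable D a (\<lambda>p xs. P p xs \<and> Q p xs)"
proof (rule computable_cong)
  show "computable D a (\<lambda>p xs. of_bool (P p xs) * of_bool (Q p xs))"
    by (intro computable_mult assms)
qed simp

lemma decidable_disj:
  assumes "decidable D a P" "decidable D a Q"
  shows "decidable D a (\<lambda>p xs. P p xs \<or> Q p xs)"
proof (rule computable_cong)
  show "decidable D a (\<lambda>p xs. \<not> (\<not> P p xs \<and> \<not> Q p xs))"
    by (intro decidable_conj decidable_not assms)
qed simp

lemma decidable_iff:
  assumes "decidable D a P" "decidable D a Q"
  shows "decidable D a (\<lambda>p xs. P p xs \<longleftrightarrow> Q p xs)"
proof (rule computable_cong)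
  show "decidable D a (\<lambda>p xs. (P p xs \<and> Q p xs) \<or> (\<not> P p xs \<and> \<not> Q p xs))"
    by (intro decidable_disj decidable_conj decidable_not assms)
qed auto

lemma decidable_eq_0:
  assumes "computable D a f"
  shows "decidable D a (\<lambda>p xs. f p xs = 0)"
proof (rule computable_cong)
  show "computable D a (\<lambda>p xs. 1 - f p xs)"
    by (intro computable_diff computable_const assms)
qed auto

lemma decidable_less:
  assumes "computable D a f" "computable D a g"
  shows "decidable D a (\<lambda>p xs. f p xs < g p xs)"
proof (rule computable_cong)
  show "decidable D a (\<lambda>p xs. \<not> (g p xs - f p xs = 0))"
    by (intro decidable_not decidable_eq_0 computable_diff assms)
qed auto

lemma decidable_odd:
  assumes "computable D a f"
  shows "decidable D a (\<lambda>p xs. odd (f p xs))"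
proof (rule computable_cong)
  show "computable D a (\<lambda>p xs. rec_nat 0 (\<lambda>n v. 1 - v) (f p xs))"
    by (intro computable_rec_nat assms computable_diff computable_nth computable_const) simp
  have "rec_nat 0 (\<lambda>n v. 1 - v) x = (of_bool (odd x) :: nat)" for x by (induction x) auto
  then show "(of_bool (odd (f p xs)) :: nat) = rec_nat 0 (\<lambda>n v. 1 - v) (f p xs)" for p xs by simp
qed

text \<open>\<open>x div 2\<close> is the number of odd numbers below \<open>x\<close>.\<close>

lemma computable_div2:
  assumes "computable D a f"
  shows "computable D a (\<lambda>p xs. f p xs div 2)"
proof (rule computable_cong)
  show "computable D a (\<lambda>p xs. rec_nat 0 (\<lambda>n v. v + of_bool (odd n)) (f p xs))"
    by (intro computable_rec_nat assms computable_add decidable_odd computable_nth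
        computable_const) simp_all
  have "rec_nat 0 (\<lambda>n v. v + of_bool (odd n)) x = x div 2" for x :: nat
    by (induction x) auto
  then show "f p xs div 2 = rec_nat 0 (\<lambda>n v. v + of_bool (odd n)) (f p xs)" for p xs by simp
qed

lemma computable_power2:
  assumes "computable D a f"
  shows "computable D a (\<lambda>p xs. 2 ^ f p xs)"
proof (rule computable_cong)
  show "computable D a (\<lambda>p xs. rec_nat 1 (\<lambda>n v. v + v) (f p xs))"
    by (intro computable_rec_nat assms computable_add computable_nth computable_const) simp_all
  have "rec_nat 1 (\<lambda>n v. v + v) x = (2 ^ x :: nat)" for x by (induction x) auto
  then show "(2 ^ f p xs :: nat) = rec_nat 1 (\<lambda>n v. v + v) (f p xs)" for p xs by simp
qed

lemma computable_triangle:
  assumes "computable D a f"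
  shows "computable D a (\<lambda>p xs. triangle (f p xs))"
proof (rule computable_cong)
  show "computable D a (\<lambda>p xs. rec_nat 0 (\<lambda>n v. v + Suc n) (f p xs))"
    by (intro computable_rec_nat assms computable_add computable_Suc computable_nth
        computable_const) simp_all
  have "rec_nat 0 (\<lambda>n v. v + Suc n) x = triangle x" for x by (induction x) auto
  then show "triangle (f p xs) = rec_nat 0 (\<lambda>n v. v + Suc n) (f p xs)" for p xs by simp
qed

lemma computable_prod_encode:
  assumes "computable D a f" "computable D a g"
  shows "computable D a (\<lambda>p xs. prod_encode (f p xs, g p xs))"
  unfolding prod_encode_def prod.case
  by (intro computable_add computable_triangle assms)

section \<open>Bounded quantifiers and minimization\<close>

lemma decidable_all_less:
  assumes h: "computable D a h"
    and P: "decidable D (Suc a) (\<lambda>p ys. P p (ys ! 0) (drop 1 ys))"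
  shows "decidable D a (\<lambda>p xs. \<forall>i<h p xs. P p i xs)"
proof (rule computable_cong)
  obtain c where c: "\<And>p ys. p \<in> D \<Longrightarrow> length ys = Suc a \<Longrightarrow>
      eval c p ys = Some (of_bool (P p (ys ! 0) (drop 1 ys)))"
    using P unfolding computable_def by blast
  \<comment> \<open>The recursion step receives the accumulated truth value between \<open>i\<close>
    and the parameters; the program for \<open>P\<close> has to be run without it.\<close>
  have "decidable D (Suc (Suc a)) (\<lambda>p ys. P p (ys ! 0) (drop 2 ys))"
  proof (rule computableI[where c = "Comp c (Proj 0 # map Proj [2..<2 + a])"])
    fix p and ys :: "nat list" assume p: "p \<in> D" and ys: "length ys = Suc (Suc a)"
    have "eval (Comp c (Proj 0 # map Proj [2..<2 + a])) p ys = eval c p (ys ! 0 # drop 2 ys)"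
      by (subst eval.simps(5), subst list.map, subst list.map, subst map_eval_Proj)
        (auto simp: ys o_def Let_def)
    then show "eval (Comp c (Proj 0 # map Proj [2..<2 + a])) p ys =
        Some (of_bool (P p (ys ! 0) (drop 2 ys)))"
      by (simp add: c p ys)
  qed
  then show "computable D a (\<lambda>p xs. rec_nat 1 (\<lambda>i v. v * of_bool (P p i xs)) (h p xs))"
    by (intro computable_rec_nat h computable_mult computable_nth computable_const) simp_all
  have "rec_nat 1 (\<lambda>i v. v * of_bool (Q i)) n = (of_bool (\<forall>i<n. Q i) :: nat)" for Q n
    by (induction n) (auto simp: less_Suc_eq)
  then show "(of_bool (\<forall>i<h p xs. P p i xs) :: nat) = rec_nat 1 (\<lambda>i v. v * of_bool (P p i xs)) (h p xs)"
    for p xs by simp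
qed

lemma decidable_ex_less:
  assumes "computable D a h"
    and "decidable D (Suc a) (\<lambda>p ys. P p (ys ! 0) (drop 1 ys))"
  shows "decidable D a (\<lambda>p xs. \<exists>i<h p xs. P p i xs)"
proof (rule computable_cong)
  show "decidable D a (\<lambda>p xs. \<not> (\<forall>i<h p xs. \<not> P p i xs))"
    by (intro decidable_not decidable_all_less assms)
qed simp

text \<open>\<open>Mu\<close> searches for a zero, so it is applied to the negation of
  \<open>P\<close>. The assumption \<open>ex\<close> makes the search terminate for oracles in
  \<open>D\<close>.\<close>

lemma computable_Least:
  assumes P: "decidable D (Suc a) (\<lambda>p ys. P p (ys ! 0) (drop 1 ys))"
    and ex: "\<And>p xs. p \<in> D \<Longrightarrow> length xs = a \<Longrightarrow> \<exists>n. P p n xs"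
  shows "computable D a (\<lambda>p xs. LEAST n. P p n xs)"
proof -
  obtain c where c: "\<And>p ys. p \<in> D \<Longrightarrow> length ys = Suc a \<Longrightarrow>
      eval c p ys = Some (of_bool (\<not> P p (ys ! 0) (drop 1 ys)))"
    using decidable_not[OF P] unfolding computable_def by blast
  have "eval (Mu c) p xs = Some (LEAST n. P p n xs)" if "p \<in> D" "length xs = a" for p xs
    using ex[OF that] by (simp add: c that)
  then show ?thesis by (rule computableI)
qed

text \<open>The Cantor pairing enumerates the diagonals \<open>m + n = s\<close> one after the other.\<close>

lemma prod_decode_eq:
  fixes x :: nat
  defines "s \<equiv> LEAST s. x < triangle (Suc s)"
  shows "fst (prod_decode x) = x - triangle s"
    and "snd (prod_decode x) = s - (x - triangle s)"
proof -
  obtain m n where mn: "prod_decode x = (m, n)" by (cases "prod_decode x")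
  then have x: "x = triangle (m + n) + m"
    using prod_decode_inverse[of x] by (simp add: prod_encode_def)
  have mono: "triangle i \<le> triangle j" if "i \<le> j" for i j
    using that by (induction rule: dec_induct) auto
  have "s = m + n"
    unfolding s_def
  proof (rule Least_equality)
    show "x < triangle (Suc (m + n))" by (simp add: x)
  next
    fix y assume y: "x < triangle (Suc y)"
    show "m + n \<le> y"
    proof (rule ccontr)
      assume "\<not> m + n \<le> y"
      then have "triangle (Suc y) \<le> triangle (m + n)" by (intro mono) simp
      with x y show False by simp
    qed
  qed
  then show "fst (prod_decode x) = x - triangle s"
    and "snd (prod_decode x) = s - (x - triangle s)"
    unfolding \<open>s = m + n\<close> mn by (simp_all add: x)
qed

lemma computable_diagonal:
  assumes "computable D a f"
  shows "computable D a (\<lambda>p xs. LEAST s. f p xs < triangle (Suc s))"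
proof (rule computable_Least)
  show "decidable D (Suc a) (\<lambda>p ys. f p (drop 1 ys) < triangle (Suc (ys ! 0)))"
    using computable_drop[OF assms, of 1]
    by (intro decidable_less computable_triangle computable_Suc computable_nth) simp_all
  have "n \<le> triangle n" for n by (induction n) auto
  then have "f p xs < triangle (Suc (f p xs))" for p xs by (metis Suc_le_eq)
  then show "\<exists>s. f p xs < triangle (Suc s)" for p xs by blast
qed

lemma computable_prod_decode:
  assumes "computable D a f"
  shows "computable D a (\<lambda>p xs. fst (prod_decode (f p xs)))"
    and "computable D a (\<lambda>p xs. snd (prod_decode (f p xs)))"
  unfolding prod_decode_eq
  by (intro computable_diff computable_triangle computable_diagonal assms)+

section \<open>Realizers given by decidable predicates\<close>

text \<open>Row \<open>n\<close> of the matrix \<open>q\<close> becomes the name of component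
  \<open>n\<close>; the decoding undoes the pairing in \<open>delta_Tw\<close>.\<close>

definition tabulate :: "(nat \<Rightarrow> nat \<Rightarrow> bool) \<Rightarrow> nat \<Rightarrow> bool" where
  "tabulate q m = (case prod_decode m of (n, k) \<Rightarrow> q n k)"

lemma delta_Tw_tabulate: "delta_Tw (tabulate q) n = delta_T (q n)"
  by (simp add: delta_Tw_def tabulate_def)

lemma delta_T_eq_None_iff: "delta_T q = None \<longleftrightarrow> (\<forall>k. \<not> q k)"
  by (simp add: delta_T_def)

lemma delta_T_eq_Some_iff:
  "delta_T q = Some b \<longleftrightarrow> (\<exists>k. q k \<and> (\<forall>j<k. \<not> q j) \<and> odd k = b)"
proof
  assume "delta_T q = Some b"
  then have "\<exists>k. q k" "odd (LEAST k. q k) = b"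
    by (auto simp: delta_T_def split: if_splits)
  then show "\<exists>k. q k \<and> (\<forall>j<k. \<not> q j) \<and> odd k = b"
    using LeastI_ex[of q] not_less_Least[of _ q] by blast
next
  assume "\<exists>k. q k \<and> (\<forall>j<k. \<not> q j) \<and> odd k = b"
  then obtain k where k: "q k" "\<forall>j<k. \<not> q j" "odd k = b" by blast
  then have "(LEAST k. q k) = k" by (metis LeastI not_less_Least linorder_neqE_nat)
  with k show "delta_T q = Some b" by (auto simp: delta_T_def)
qed

text \<open>A defined component \<open>b\<close> is named by a single entry, at position 0 or 1
  according to \<open>b\<close>. Surjectivity is needed because a realizer acts on points, while the
  constructions below start from names.\<close>

lemma surj_delta_Tw: "surj delta_Tw"
proof (rule surjI)
  fix p :: "nat \<Rightarrow> plotkin"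
  show "delta_Tw (tabulate (\<lambda>n k. p n = Some (odd k) \<and> k < 2)) = p"
  proof
    fix n
    show "delta_Tw (tabulate (\<lambda>n k. p n = Some (odd k) \<and> k < 2)) n = p n"
    proof (cases "p n")
      case None
      then show ?thesis by (simp add: delta_Tw_tabulate delta_T_eq_None_iff)
    next
      case (Some b)
      then show ?thesis
        by (auto simp: delta_Tw_tabulate delta_T_eq_Some_iff intro!: exI[of _ "of_bool b"])
    qed
  qed
qed

text \<open>Reduces computability to a decidable matrix \<open>q r\<close> that tabulates a name of
  some admissible value. The functions \<open>f\<close> and \<open>g\<close> in \<open>dec\<close>
  leave room to substitute the two components of a decoded position.\<close>

lemma Tw_map_computableI:
  assumes dec: "\<And>D a f g. \<lbrakk>\<And>r. r \<in> D \<Longrightarrow> \<exists>y. \<psi>Y (delta_Tw r) = Some y;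
      computable D a f; computable D a g\<rbrakk> \<Longrightarrow> decidable D a (\<lambda>r xs. q r (f r xs) (g r xs))"
    and corr: "\<And>r y. \<psi>Y (delta_Tw r) = Some y \<Longrightarrow>
      \<exists>z\<in>f y. \<psi>Z (delta_Tw (tabulate (q r))) = Some z"
  shows "Tw_map_computable \<psi>Y \<psi>Z f"
proof -
  define D where "D = {r. \<exists>y. \<psi>Y (delta_Tw r) = Some y}"
  \<comment> \<open>\<open>q r\<close> may depend on the name \<open>r\<close>, but a realizer
    depends on the point only; so \<open>F\<close> collects all names of all admissible
    values.\<close>
  define F where "F p = {t. \<exists>y. \<psi>Y p = Some y \<and> (\<exists>z\<in>f y. \<psi>Z t = Some z)}" for p
  define G where "G r = (if r \<in> D then Some (tabulate (q r)) else None)" for r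
  have "decidable D 1 (\<lambda>r xs. q r (fst (prod_decode (xs ! 0))) (snd (prod_decode (xs ! 0))))"
    by (intro dec computable_prod_decode computable_nth) (auto simp: D_def)
  then obtain c where c: "\<And>r xs. r \<in> D \<Longrightarrow> length xs = 1 \<Longrightarrow>
      eval c r xs = Some (of_bool (q r (fst (prod_decode (xs ! 0))) (snd (prod_decode (xs ! 0)))))"
    unfolding computable_def by blast
  have "cantor_computable G"
    unfolding cantor_computable_def
    by (intro exI[of _ c]) (auto simp: c G_def tabulate_def split_beta split: if_splits)
  moreover have "\<exists>s. G r = Some s \<and> delta_Tw s \<in> F (delta_Tw r)" if "delta_Tw r \<in> mdom F" for r
    using that corr by (fastforce simp: mdom_def F_def G_def D_def)
  ultimately have "Tw_computable F"
    unfolding Tw_computable_def by blast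
  moreover have "Tw_realizer \<psi>Y \<psi>Z F f"
    unfolding Tw_realizer_def
  proof (intro allI impI, elim conjE, intro conjI)
    fix p y assume y: "\<psi>Y p = Some y"
    obtain r where "p = delta_Tw r" using surjD[OF surj_delta_Tw] by blast
    with y corr show "F p \<noteq> {}" unfolding F_def by blast
    show "F p \<subseteq> dom \<psi>Z" "(\<lambda>q. the (\<psi>Z q)) ` F p \<subseteq> f y"
      using y by (auto simp: F_def)
  qed
  ultimately show ?thesis unfolding Tw_map_computable_def by blast
qed

section \<open>Pruning\<close>

lemma nu_inv: "nu (inv nu w) = w"
  using bij_nu by (simp add: bij_def surj_f_inv_f)

lemma nu_child: "nu (Suc (2 * n + of_bool b)) = nu n @ [b]"
  by simp

lemma Prune_eqI:
  assumes "T \<in> binary_trees" "P \<in> pruned_trees" "paths P = paths T"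
  shows "Prune T = P"
  unfolding Prune_def using Prune_unique_exists[OF assms(1)] assms(2,3)
  by (intro the1_equality) auto

section \<open>Extensions of words and Koenig's lemma\<close>

lemma binary_trees_prefix: "T \<in> binary_trees \<Longrightarrow> v @ u \<in> T \<Longrightarrow> v \<in> T"
  by (auto simp: binary_trees_def)

lemma binary_trees_extension_mono:
  assumes "T \<in> binary_trees" "w @ v \<in> T" "k \<le> length v"
  shows "\<exists>u. length u = k \<and> w @ u \<in> T"
proof -
  have "(w @ take k v) @ drop k v \<in> T" using assms(2) by simp
  with assms(1) have "w @ take k v \<in> T" by (rule binary_trees_prefix)
  with assms(3) show ?thesis by (intro exI[of _ "take k v"]) simp
qed

lemma Prune_pruned: "T \<in> binary_trees \<Longrightarrow> Prune T \<in> pruned_trees"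
  unfolding Prune_def using theI'[OF Prune_unique_exists, of T] by blast

text \<open>This is Koenig's lemma. The words with extensions of every length form a pruned tree,
  since a word has only two children: if both had bounded extensions, so would the word.\<close>

lemma Prune_eq:
  assumes T: "T \<in> binary_trees"
  shows "Prune T = {w. \<forall>k. \<exists>v. length v = k \<and> w @ v \<in> T}" (is "_ = ?P")
proof (rule Prune_eqI[OF T])
  show "?P \<in> pruned_trees"
    unfolding pruned_trees_iff_snoc binary_trees_iff_snoc
  proof (intro conjI allI impI ballI)
    fix w b assume w: "w @ [b] \<in> ?P"
    have "\<exists>v. length v = k \<and> w @ v \<in> T" for k
    proof -
      obtain v where "length v = k" "w @ [b] @ v \<in> T" using w by auto
      then show ?thesis by (intro binary_trees_extension_mono[OF T]) auto
    qed
    then show "w \<in> ?P" by simp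
  next
    fix w assume w: "w \<in> ?P"
    show "\<exists>b. w @ [b] \<in> ?P"
    proof (rule ccontr)
      assume "\<nexists>b. w @ [b] \<in> ?P"
      then have "\<forall>b. \<exists>k. \<nexists>v. length v = k \<and> (w @ [b]) @ v \<in> T" by blast
      then obtain k where k: "\<And>b v. length v = k b \<Longrightarrow> (w @ [b]) @ v \<notin> T" by metis
      \<comment> \<open>The sum of the two bounds serves both children at once; \<open>Suc\<close>
        accounts for the letter leading to the child.\<close>
      obtain v where v: "length v = Suc (k False + k True)" "w @ v \<in> T" using w by blast
      then obtain b u where u: "v = b # u" by (cases v) auto
      have "\<exists>u'. length u' = k b \<and> (w @ [b]) @ u' \<in> T"
        by (rule binary_trees_extension_mono[OF T, of _ u]) (use u v in \<open>cases b; simp\<close>)+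
      with k show False by blast
    qed
  qed
  show "paths ?P = paths T"
  proof (intro equalityI subsetI)
    fix q assume "q \<in> paths ?P"
    then have "\<exists>v. length v = 0 \<and> map q [0..<n] @ v \<in> T" for n
      unfolding paths_def by blast
    then show "q \<in> paths T" by (simp add: paths_def)
  next
    fix q assume q: "q \<in> paths T"
    have "\<exists>v. length v = k \<and> map q [0..<n] @ v \<in> T" for n k
    proof (intro exI conjI)
      show "length (map q [n..<n + k]) = k" by simp
      have "map q [0..<n + k] \<in> T" using q by (simp add: paths_def)
      then show "map q [0..<n] @ map q [n..<n + k] \<in> T"
        using upt_add_eq_append[of 0 n k] by simp
    qed
    then show "q \<in> paths ?P" by (simp add: paths_def)
  qed
qed

section \<open>A name of the pruned tree\<close>

text \<open>\<open>Suc i\<close> in binary is 1 followed by \<open>nu i\<close>. Appending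
  \<open>k\<close> letters gives \<open>Suc i * 2 ^ k + d\<close> with \<open>d < 2 ^ k\<close>, so
  the extensions by \<open>k\<close> letters occupy an interval of indices and can be
  searched.\<close>

lemma extensions_interval:
  "(\<exists>d<2 ^ k. P (nu (Suc i * 2 ^ k + d - 1))) \<longleftrightarrow> (\<exists>v. length v = k \<and> P (nu i @ v))"
proof (induction k arbitrary: P)
  case (Suc k)
  have split: "(\<exists>d<2 ^ Suc k. R d) \<longleftrightarrow> (\<exists>d<2 ^ k. \<exists>b. R (2 * d + of_bool b))"
    for R :: "nat \<Rightarrow> bool"
  proof
    assume "\<exists>d<2 ^ Suc k. R d"
    then obtain d where "d < 2 ^ Suc k" "R d" by blast
    then show "\<exists>d<2 ^ k. \<exists>b. R (2 * d + of_bool b)"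
      by (intro exI[of _ "d div 2"] conjI exI[of _ "odd d"]) auto
  next
    assume "\<exists>d<2 ^ k. \<exists>b. R (2 * d + of_bool b)"
    then obtain d b where "d < 2 ^ k" "R (2 * d + of_bool b)" by blast
    then show "\<exists>d<2 ^ Suc k. R d"
      by (intro exI[of _ "2 * d + of_bool b"]) auto
  qed
  have child: "Suc i * 2 ^ Suc k + (2 * d + of_bool b) - 1 =
      Suc (2 * (Suc i * 2 ^ k + d - 1) + of_bool b)" for d and b :: bool
  proof -
    obtain m where "Suc i * 2 ^ k + d = Suc m" by (cases "Suc i * 2 ^ k + d") auto
    moreover have "Suc i * 2 ^ Suc k + (2 * d + of_bool b) =
        2 * (Suc i * 2 ^ k + d) + of_bool b" by (simp add: algebra_simps)
    ultimately show ?thesis by simp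
  qed
  have "(\<exists>d<2 ^ Suc k. P (nu (Suc i * 2 ^ Suc k + d - 1))) \<longleftrightarrow>
      (\<exists>d<2 ^ k. \<exists>b. P (nu (Suc i * 2 ^ k + d - 1) @ [b]))"
    unfolding split child nu_child ..
  also have "\<dots> \<longleftrightarrow> (\<exists>v. length v = k \<and> (\<exists>b. P ((nu i @ v) @ [b])))"
    \<comment> \<open>The induction hypothesis is used for the words having a child in
      \<open>P\<close>, which is why \<open>P\<close> is kept arbitrary.\<close>
    by (rule Suc.IH)
  also have "\<dots> \<longleftrightarrow> (\<exists>v. length v = Suc k \<and> P (nu i @ v))"
    by (auto simp: length_Suc_conv_rev)
  finally show ?case .
qed simp

text \<open>
  For \<open>n > 0\<close> the index \<open>2 * n - of_bool (odd k)\<close> is that of the child with label \<open>even k\<close> of the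
  word with index \<open>n - 1\<close>; for \<open>n = 0\<close> truncated subtraction makes it the root.
\<close>

definition dead :: "(nat \<Rightarrow> bool) \<Rightarrow> nat \<Rightarrow> nat \<Rightarrow> bool" where
  "dead t n k \<longleftrightarrow>
     (\<forall>d<2 ^ k. \<not> t (Suc (2 * n - of_bool (odd k)) * 2 ^ k + d - 1))"

lemma dead_iff:
  "dead (\<lambda>n. nu n \<in> T) n k \<longleftrightarrow>
     (\<nexists>v. length v = k \<and> nu (2 * n - of_bool (odd k)) @ v \<in> T)"
  using extensions_interval[of k "\<lambda>w. w \<in> T" "2 * n - of_bool (odd k)"]
  unfolding dead_def by blast

lemma nu_even_child: "nu (2 * Suc n - of_bool (odd k)) = nu n @ [even k]"
  using nu_child[of n "even k"] by (cases "even k") auto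

text \<open>Level \<open>k\<close> tests the child labelled \<open>even k\<close>, and a first hit
  at \<open>k\<close> yields the value \<open>odd k\<close>, the label of the other child. Below a
  word of \<open>Prune T\<close> at most one child dies, so all hits have the same parity and the
  first one is right.\<close>

lemma PT_tree_dead:
  assumes T: "T \<in> binary_trees"
  shows "PT_tree (delta_Tw (tabulate (dead (\<lambda>n. nu n \<in> T)))) = Prune T"
proof -
  let ?p = "delta_Tw (tabulate (dead (\<lambda>n. nu n \<in> T)))"
  have "w \<in> PT_tree ?p \<longleftrightarrow> w \<in> Prune T" for w
  proof (induction w rule: rev_induct)
    case Nil
    show ?case
      by (auto simp: PT_tree_Nil_iff delta_Tw_tabulate delta_T_eq_None_iff dead_iff Prune_eq[OF T])
  next
    case (snoc b w)
    have dead: "dead (\<lambda>n. nu n \<in> T) (inv nu w + 1) k \<longleftrightarrow>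
        (\<nexists>v. length v = k \<and> (w @ [even k]) @ v \<in> T)" for k
      unfolding dead_iff by (simp only: Suc_eq_plus1[symmetric] nu_even_child nu_inv)
    have "?p (inv nu w + 1) \<noteq> Some (\<not> b)" if "w @ [b] \<in> Prune T"
    proof
      assume "?p (inv nu w + 1) = Some (\<not> b)"
      then obtain k where "dead (\<lambda>n. nu n \<in> T) (inv nu w + 1) k" "even k = b"
        unfolding delta_Tw_tabulate delta_T_eq_Some_iff by blast
      with that show False unfolding dead Prune_eq[OF T] by blast
    qed
    moreover have "?p (inv nu w + 1) = Some (\<not> b)" if w: "w \<in> Prune T" "w @ [b] \<notin> Prune T"
    proof -
      obtain c where "w @ [c] \<in> Prune T"
        using Prune_pruned[OF T] w(1) unfolding pruned_trees_iff_snoc by blast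
      with w(2) have "w @ [\<not> b] \<in> Prune T" by (cases "c = b") auto
      then have only: "even k = b" if "dead (\<lambda>n. nu n \<in> T) (inv nu w + 1) k" for k
        using that unfolding dead Prune_eq[OF T] by (cases "even k = b") auto
      obtain l where l: "\<nexists>v. length v = l \<and> (w @ [b]) @ v \<in> T"
        using w(2) unfolding Prune_eq[OF T] by blast
      \<comment> \<open>A level beyond \<open>l\<close> whose parity selects the child
        \<open>b\<close>; death at \<open>l\<close> persists there.\<close>
      define k where "k = 2 * l + of_bool (\<not> b)"
      have "even k = b" "l \<le> k" by (simp_all add: k_def)
      then have "dead (\<lambda>n. nu n \<in> T) (inv nu w + 1) k"
        unfolding dead using l binary_trees_extension_mono[OF T] by blast
      then have "?p (inv nu w + 1) \<noteq> None"
        by (auto simp: delta_Tw_tabulate delta_T_eq_None_iff)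
      then obtain c where c: "?p (inv nu w + 1) = Some c" by blast
      then obtain j where "dead (\<lambda>n. nu n \<in> T) (inv nu w + 1) j" "odd j = c"
        by (auto simp: delta_Tw_tabulate delta_T_eq_Some_iff)
      with only c show ?thesis by auto
    qed
    moreover have "w \<in> Prune T" if "w @ [b] \<in> Prune T"
      using Prune_pruned[OF T] that unfolding pruned_trees_iff_snoc binary_trees_iff_snoc by blast
    ultimately show ?case
      using snoc unfolding PT_tree_snoc_iff by blast
  qed
  then show ?thesis by blast
qed

section \<open>Decidability of death from a name of the tree\<close>

text \<open>Meant for components different from bottom, where the least hit exists and can be found
  by search.\<close>

definition read_bit :: "(nat \<Rightarrow> bool) \<Rightarrow> nat \<Rightarrow> bool" where
  "read_bit r n = odd (LEAST k. r (prod_encode (n, k)))"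

lemma Tw_of_cantor_delta_tree_eq_Some:
  assumes "Tw_of_cantor delta_tree (delta_Tw r) = Some T"
  shows "T \<in> binary_trees" and "read_bit r = (\<lambda>n. nu n \<in> T)"
    and "\<exists>k. r (prod_encode (n, k))"
proof -
  have no: "None \<notin> range (delta_Tw r)"
    and T: "T \<in> binary_trees" "(\<lambda>n. the (delta_Tw r n)) = (\<lambda>n. nu n \<in> T)"
    using assms by (auto simp: Tw_of_cantor_def delta_tree_eq_Some_iff split: if_splits)
  show ex: "\<exists>k. r (prod_encode (n, k))" for n
  proof -
    have "delta_Tw r n \<noteq> None" using no by (metis rangeI)
    then show ?thesis by (simp add: delta_Tw_def delta_T_eq_None_iff)
  qed
  have "read_bit r n = the (delta_Tw r n)" for n
    using ex by (simp add: read_bit_def delta_Tw_def delta_T_def)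
  with T(2) show "read_bit r = (\<lambda>n. nu n \<in> T)" by (simp add: fun_eq_iff)
  show "T \<in> binary_trees" by (rule T(1))
qed

lemma decidable_read_bit:
  assumes ex: "\<And>r n. r \<in> D \<Longrightarrow> \<exists>k. r (prod_encode (n, k))" and f: "computable D a f"
  shows "decidable D a (\<lambda>r xs. read_bit r (f r xs))"
  unfolding read_bit_def
proof (intro decidable_odd computable_Least)
  show "decidable D (Suc a) (\<lambda>r ys. r (prod_encode (f r (drop 1 ys), ys ! 0)))"
    using computable_drop[OF f, of 1]
    by (intro decidable_query computable_prod_encode computable_nth) simp_all
qed (use ex in blast)

lemma decidable_dead:
  assumes ex: "\<And>r n. r \<in> D \<Longrightarrow> \<exists>k. r (prod_encode (n, k))"
    and fg: "computable D a f" "computable D a g"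
  shows "decidable D a (\<lambda>r xs. dead (read_bit r) (f r xs) (g r xs))"
  unfolding dead_def
proof (intro decidable_all_less)
  have "computable D (Suc a) (\<lambda>r ys. f r (drop 1 ys))" "computable D (Suc a) (\<lambda>r ys. g r (drop 1 ys))"
    using fg[THEN computable_drop, of 1] by simp_all
  then show "decidable D (Suc a) (\<lambda>r ys. \<not> read_bit r
      (Suc (2 * f r (drop 1 ys) - of_bool (odd (g r (drop 1 ys)))) * 2 ^ g r (drop 1 ys) + ys ! 0 - 1))"
    by (intro decidable_not decidable_read_bit ex computable_diff computable_add computable_mult
        computable_Suc computable_power2 decidable_odd computable_const computable_nth) simp_all
qed (intro computable_power2 fg)

lemma Prune_computable:
  "Tw_map_computable (Tw_of_cantor delta_tree) delta_PT (\<lambda>T. {Prune T})"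
proof (rule Tw_map_computableI[where q = "\<lambda>r. dead (read_bit r)"])
  fix D a f g
  assume "\<And>r. r \<in> D \<Longrightarrow> \<exists>T. Tw_of_cantor delta_tree (delta_Tw r) = Some T"
    and fg: "computable D a f" "computable D a g"
  then have "\<exists>k. r (prod_encode (n, k))" if "r \<in> D" for r n
    using that Tw_of_cantor_delta_tree_eq_Some(3) by blast
  then show "decidable D a (\<lambda>r xs. dead (read_bit r) (f r xs) (g r xs))"
    using fg by (rule decidable_dead)
next
  fix r T assume "Tw_of_cantor delta_tree (delta_Tw r) = Some T"
  note T = Tw_of_cantor_delta_tree_eq_Some(1,2)[OF this]
  show "\<exists>P\<in>{Prune T}. delta_PT (delta_Tw (tabulate (dead (read_bit r)))) = Some P"
    by (simp add: delta_PT_def T(2) PT_tree_dead[OF T(1)])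
qed

section \<open>The inverse of pruning\<close>

text \<open>The parent has index \<open>(n - 1) div 2\<close>; truncated subtraction makes the root its own parent.\<close>

definition ancestor :: "nat \<Rightarrow> nat \<Rightarrow> nat" where
  "ancestor n j = rec_nat n (\<lambda>_ x. (x - 1) div 2) j"

lemma ancestor_simps [simp]:
  "ancestor n 0 = n" "ancestor n (Suc j) = (ancestor n j - 1) div 2"
  by (simp_all add: ancestor_def)

text \<open>The recursion splits off the last step upwards; this splits off the first.\<close>

lemma ancestor_parent: "ancestor ((n - 1) div 2) j = ancestor n (Suc j)"
  by (induction j) simp_all

text \<open>
  The component \<open>(x + 1) div 2\<close> of a name controls the word with index \<open>x\<close>: it is component 0 for
  the root, and the component of the parent otherwise. Since the last letter of a nonempty
  \<open>nu x\<close> is \<open>even x\<close>, this word is removed by the value \<open>odd x\<close>.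
\<close>

definition removed :: "(nat \<Rightarrow> bool) \<Rightarrow> nat \<Rightarrow> nat \<Rightarrow> bool" where
  "removed r s x \<longleftrightarrow> (\<exists>k<s. r (prod_encode ((x + 1) div 2, k)) \<and>
     (\<forall>j<k. \<not> r (prod_encode ((x + 1) div 2, j))) \<and> (x = 0 \<or> odd k = odd x))"

text \<open>The index \<open>n\<close> serves both as the stage up to which the name is read and as
  the number of steps upwards. It is at least the length of \<open>nu n\<close>, so the ancestors
  include all prefixes.\<close>

definition survives :: "(nat \<Rightarrow> bool) \<Rightarrow> nat \<Rightarrow> bool" where
  "survives r n \<longleftrightarrow> (\<forall>j<Suc n. \<not> removed r n (ancestor n j))"

section \<open>Removed words and the tree of the name\<close>

lemma removed_mono: "removed r s x \<Longrightarrow> s \<le> s' \<Longrightarrow> removed r s' x"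
  unfolding removed_def by (meson less_le_trans)

lemma PT_tree_0_iff: "nu 0 \<in> PT_tree (delta_Tw r) \<longleftrightarrow> (\<nexists>s. removed r s 0)"
proof
  assume "nu 0 \<in> PT_tree (delta_Tw r)"
  then show "\<nexists>s. removed r s 0"
    by (auto simp: PT_tree_Nil_iff delta_Tw_def delta_T_eq_None_iff removed_def)
next
  assume none: "\<nexists>s. removed r s 0"
  have "delta_Tw r 0 \<noteq> Some b" for b
    using none by (auto simp: delta_Tw_def delta_T_eq_Some_iff removed_def)
  then show "nu 0 \<in> PT_tree (delta_Tw r)"
    by (auto simp: PT_tree_Nil_iff)
qed

lemma PT_tree_Suc_iff:
  "nu (Suc n) \<in> PT_tree (delta_Tw r) \<longleftrightarrow>
     nu (n div 2) \<in> PT_tree (delta_Tw r) \<and> (\<nexists>s. removed r s (Suc n))"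
proof -
  have "inv nu (nu m) = m" for m using bij_nu by (simp add: bij_def)
  \<comment> \<open>The last letter of \<open>nu (Suc n)\<close> is \<open>odd n\<close>; the value
    excluding it is \<open>even n\<close>, that is, \<open>odd (Suc n)\<close>.\<close>
  moreover have "delta_Tw r (Suc (n div 2)) = Some (even n) \<longleftrightarrow> (\<exists>s. removed r s (Suc n))"
    by (auto simp: delta_Tw_def delta_T_eq_Some_iff removed_def)
  ultimately show ?thesis by (simp add: PT_tree_snoc_iff)
qed

lemma PT_tree_ancestor:
  "nu n \<in> PT_tree (delta_Tw r) \<Longrightarrow> \<not> removed r s (ancestor n j)"
proof -
  assume "nu n \<in> PT_tree (delta_Tw r)"
  then have "nu (ancestor n j) \<in> PT_tree (delta_Tw r)"
  proof (induction j)
    case (Suc j)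
    then show ?case by (cases "ancestor n j") (auto simp del: nu.simps simp: PT_tree_Suc_iff)
  qed simp
  then show ?thesis
    by (cases "ancestor n j") (auto simp del: nu.simps simp: PT_tree_Suc_iff PT_tree_0_iff)
qed

text \<open>The parent is tested at an earlier stage, and only against ancestors that the child is
  tested against as well.\<close>

lemma survives_parent:
  assumes "survives r (Suc n)"
  shows "survives r (n div 2)"
  unfolding survives_def
proof (intro allI impI notI)
  fix j assume j: "j < Suc (n div 2)" and rem: "removed r (n div 2) (ancestor (n div 2) j)"
  have "ancestor (n div 2) j = ancestor (Suc n) (Suc j)"
    using ancestor_parent[of "Suc n" j] by simp
  moreover have "n div 2 \<le> Suc n" by simp
  ultimately have "removed r (Suc n) (ancestor (Suc n) (Suc j))"
    using removed_mono[OF rem] by metis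
  moreover have "Suc j < Suc (Suc n)" using j by auto
  ultimately show False using assms unfolding survives_def by blast
qed

lemma survives_tree: "{w. survives r (inv nu w)} \<in> binary_trees"
  unfolding binary_trees_iff_snoc mem_Collect_eq
proof (intro allI impI)
  fix w b assume "survives r (inv nu (w @ [b]))"
  moreover have "inv nu (w @ [b]) = Suc (2 * inv nu w + of_bool b)"
    using bij_nu nu_child[of "inv nu w" b] unfolding nu_inv by (metis bij_def inv_f_f)
  ultimately show "survives r (inv nu w)"
    using survives_parent[of r "2 * inv nu w + of_bool b"] by simp
qed

lemma prefix_ancestor:
  "\<exists>j\<le>length v. inv nu w = ancestor (inv nu (w @ v)) j"
proof (induction v rule: rev_induct)
  case (snoc b v)
  then obtain j where j: "j \<le> length v" "inv nu w = ancestor (inv nu (w @ v)) j" by blast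
  have "inv nu (w @ v @ [b]) = Suc (2 * inv nu (w @ v) + of_bool b)"
    using bij_nu nu_child[of "inv nu (w @ v)" b] unfolding nu_inv append_assoc
    by (metis bij_def inv_f_f)
  then have "ancestor (inv nu (w @ v @ [b])) (Suc j) = ancestor (inv nu (w @ v)) j"
    by (subst ancestor_parent[symmetric]) simp
  with j show ?case by (intro exI[of _ "Suc j"]) simp
qed simp

text \<open>Guarantees that long words are tested at late stages.\<close>

lemma length_nu_le: "length (nu n) \<le> n"
proof (induction n rule: nu.induct)
  case (2 n)
  then show ?case by simp
qed simp

text \<open>Words of the named tree pass every test. Conversely, no prefix of a path through the
  surviving words is ever removed, since a long enough prefix of that path would notice the removal
  and fail.\<close>

lemma Prune_survives: "Prune {w. survives r (inv nu w)} = PT_tree (delta_Tw r)"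
proof (rule Prune_eqI[OF survives_tree])
  let ?P = "PT_tree (delta_Tw r)"
  show "?P \<in> pruned_trees"
    using Tw_representation_PT by (auto simp: Tw_representation_def delta_PT_def ran_def)
  have "w \<in> {w. survives r (inv nu w)}" if "w \<in> ?P" for w
    using PT_tree_ancestor[of "inv nu w" r] that by (auto simp: nu_inv survives_def)
  then have "paths ?P \<subseteq> paths {w. survives r (inv nu w)}"
    unfolding paths_def by blast
  moreover have "q \<in> paths ?P" if q: "q \<in> paths {w. survives r (inv nu w)}" for q
  proof -
    have no: "\<not> removed r s (inv nu (map q [0..<l]))" for s l
    proof
      assume rem: "removed r s (inv nu (map q [0..<l]))"
      \<comment> \<open>With \<open>s\<close> further letters the index is at least
        \<open>s\<close>, so stage \<open>s\<close> is inspected, and the removed prefix is at most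
        \<open>s\<close> steps up.\<close>
      let ?n = "inv nu (map q [0..<l + s])"
      obtain j where j: "j \<le> s" "inv nu (map q [0..<l]) = ancestor ?n j"
        using prefix_ancestor[of "map q [l..<l + s]" "map q [0..<l]"]
        by (auto simp: upt_add_eq_append[of 0 l s, simplified])
      have "s \<le> ?n"
        using length_nu_le[of ?n] by (simp add: nu_inv)
      moreover have "survives r ?n" using q by (simp add: paths_def)
      ultimately show False
        using j rem removed_mono unfolding survives_def by (metis le_trans less_Suc_eq_le)
    qed
    have "map q [0..<l] \<in> ?P" for l
    proof (induction l)
      case 0
      have "inv nu [] = 0" using bij_nu by (metis bij_def inv_f_f nu.simps(1))
      then show ?case using no[of _ 0] PT_tree_0_iff[of r] by simp
    next
      case (Suc l)
      let ?x = "inv nu (map q [0..<Suc l])"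
      obtain n where n: "?x = Suc n"
        using nu_inv[of "map q [0..<Suc l]"] by (cases ?x) auto
      then have "nu (n div 2) = map q [0..<l]"
        using nu_inv[of "map q [0..<Suc l]"] by simp
      with Suc no[of _ "Suc l"] n PT_tree_Suc_iff[of n r] show ?case
        by (metis nu_inv)
    qed
    then show ?thesis by (simp add: paths_def)
  qed
  ultimately show "paths ?P = paths {w. survives r (inv nu w)}" by blast
qed

section \<open>Decidability of survival\<close>

lemma computable_ancestor:
  assumes "computable D a f" "computable D a g"
  shows "computable D a (\<lambda>p xs. ancestor (f p xs) (g p xs))"
  unfolding ancestor_def
  by (intro computable_rec_nat assms computable_div2 computable_diff computable_nth
      computable_const) simp

lemma decidable_removed:
  assumes "computable D a f" "computable D a g"
  shows "decidable D a (\<lambda>r xs. removed r (f r xs) (g r xs))"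
proof -
  let ?i = "\<lambda>r xs. (g r xs + 1) div 2"
  have g1: "computable D (Suc a) (\<lambda>r xs. g r (drop 1 xs))"
    using computable_drop[OF assms(2), of 1] by simp
  then have g2: "computable D (Suc (Suc a)) (\<lambda>r xs. g r (drop 1 (drop 1 xs)))"
    using computable_drop[OF g1, of 1] by simp
  have query: "decidable D (Suc a) (\<lambda>r xs. r (prod_encode (?i r (drop 1 xs), xs ! 0)))"
    by (intro decidable_query computable_prod_encode computable_div2 computable_add g1
        computable_const computable_nth) simp
  have "decidable D (Suc (Suc a)) (\<lambda>r xs. \<not> r (prod_encode (?i r (drop 1 (drop 1 xs)), xs ! 0)))"
    by (intro decidable_not decidable_query computable_prod_encode computable_div2 computable_add
        g2 computable_const computable_nth) simp
  then have first: "decidable D (Suc a)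
      (\<lambda>r xs. \<forall>j<xs ! 0. \<not> r (prod_encode (?i r (drop 1 xs), j)))"
    by (intro decidable_all_less[where P = "\<lambda>r j xs. \<not> r (prod_encode (?i r (drop 1 xs), j))"]
        computable_nth) simp_all
  have "decidable D (Suc a) (\<lambda>r xs. g r (drop 1 xs) = 0 \<or> odd (xs ! 0) = odd (g r (drop 1 xs)))"
    by (intro decidable_disj decidable_eq_0 decidable_iff decidable_odd g1 computable_nth) simp_all
  with query first show ?thesis
    unfolding removed_def by (intro decidable_ex_less decidable_conj assms(1))
qed

lemma decidable_survives:
  assumes "computable D a f"
  shows "decidable D a (\<lambda>r xs. survives r (f r xs))"
  unfolding survives_def
proof (intro decidable_all_less computable_Suc assms)
  have "computable D (Suc a) (\<lambda>r xs. f r (drop 1 xs))"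
    using computable_drop[OF assms, of 1] by simp
  then show "decidable D (Suc a) (\<lambda>r xs. \<not> removed r (f r (drop 1 xs)) (ancestor (f r (drop 1 xs)) (xs ! 0)))"
    by (intro decidable_not decidable_removed computable_ancestor computable_nth) simp_all
qed

text \<open>The first hit is at 0 or 1 according to \<open>b\<close>, so a decidable bit gets a name
  without waiting and is never bottom.\<close>

lemma delta_T_bit: "delta_T (\<lambda>k. b \<longleftrightarrow> odd k) = Some b"
  unfolding delta_T_eq_Some_iff by (rule exI[of _ "of_bool b"]) auto

text \<open>The surviving words depend on the name \<open>r\<close> and not just on
  \<open>P\<close>, but for every name of \<open>P\<close> they prune to \<open>P\<close>.\<close>

lemma Prune_inverse_computable:
  "Tw_map_computable delta_PT (Tw_of_cantor delta_tree) (\<lambda>P. {T \<in> binary_trees. Prune T = P})"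
proof (rule Tw_map_computableI[where q = "\<lambda>r n k. survives r n \<longleftrightarrow> odd k"])
  fix D a f g
  assume "computable D a f" "computable D a g"
  then show "decidable D a (\<lambda>r xs. survives r (f r xs) \<longleftrightarrow> odd (g r xs))"
    by (intro decidable_iff decidable_survives decidable_odd)
next
  fix r P assume "delta_PT (delta_Tw r) = Some P"
  then have P: "P = PT_tree (delta_Tw r)" by (simp add: delta_PT_def)
  have "inv nu (nu n) = n" for n using bij_nu by (simp add: bij_def)
  then have "Tw_of_cantor delta_tree (delta_Tw (tabulate (\<lambda>n k. survives r n \<longleftrightarrow> odd k))) =
      Some {w. survives r (inv nu w)}"
    by (auto simp: Tw_of_cantor_def delta_Tw_tabulate delta_T_bit delta_tree_eq_Some_iff
        survives_tree)
  then show "\<exists>T\<in>{T \<in> binary_trees. Prune T = P}.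
      Tw_of_cantor delta_tree (delta_Tw (tabulate (\<lambda>n k. survives r n \<longleftrightarrow> odd k))) = Some T"
    using survives_tree Prune_survives P by blast
qed

theorem theorem4:
  shows "Tw_map_computable (Tw_of_cantor delta_tree) delta_PT (\<lambda>T. {Prune T}) \<and>
         Tw_map_computable delta_PT (Tw_of_cantor delta_tree)
           (\<lambda>P. {T \<in> binary_trees. Prune T = P})"
  using Prune_computable Prune_inverse_computable ..

end
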